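(* Let $\Omega\subset\mathbb{R}^n$ be a connected bounded open set with Lipschitz boundary, $a\in L^\infty(\Omega)$ with $0<m\le a\le M$, $H\in L^2(\Omega)$, and $F,\tilde F\in L^2(\Omega;\mathbb{R}^n)$. Let $u$ and $\tilde u$ be minimizers over $H_0^1(\Omega)$ of $$\int_\Omega(a|Dw+F|+Hw)\,dx\quad\text{and}\quad\int_\Omega(a|Dw+\tilde F|+Hw)\,dx,$$ respectively, and let $J,\tilde J$ be the associated flux vector fields, with $J=\sigma(Du+F)$. If $0\le\sigma(x)\le\sigma_1$ for some constant $\sigma_1>0$, then $$\|J-\tilde J\|_{L^1(\Omega)}\le(4M\sigma_1|\Omega|)^{1/2}\,\|F-\tilde F\|_{L^1(\Omega)}^{1/2}.$$
   Context: Flux fields: $J$ is a solution of the dual problem $\sup\{\int_\Omega F\cdot b\,dx:\ b\in L^2(\Omega;\mathbb{R}^n),\ |b|\le a \text{ a.e.},\ \int_\Omega (\nabla w\cdot b+Hw)\,dx=0\ \forall w\in H^1_0(\Omega)\}$. Such a $J$ satisfies $\nabla\cdot J=H$ weakly, $|J|\le a$ a.e., $\int_\Omega F\cdot J\,dx=\min_{w\in H_0^1(\Omega)}\int_\Omega(a|Dw+F|+Hw)\,dx$, and $J=a\frac{Du+F}{|Du+F|}$ wherever $Du+F\ne0$ (a.e.), for every minimizer $u$. One sets $\sigma:=a/|Du+F|$, so $J=\sigma(Du+F)$. $\tilde J$ is defined in the same way with $\tilde F$ in place of $F$. *)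

theory Defs
  imports "HOL-Analysis.Analysis"
begin

text \<open>
  Near each boundary point, \<open>\<Omega>\<close> is the strict epigraph of a Lipschitz function in the direction of
  some unit vector \<open>e\<close>; the function lives on the hyperplane orthogonal to \<open>e\<close>, and
  \<open>x - (x \<bullet> e) *\<^sub>R e\<close> is the orthogonal projection of \<open>x\<close> onto that hyperplane.
\<close>

definition lipschitz_boundary :: "(real^'n) set \<Rightarrow> bool" where
  "lipschitz_boundary \<Omega> \<longleftrightarrow>
     (\<forall>p\<in>frontier \<Omega>. \<exists>r>0. \<exists>e L. \<exists>\<gamma> :: real^'n \<Rightarrow> real.
        norm e = 1 \<and> L-lipschitz_on {y. y \<bullet> e = 0} \<gamma> \<and>
        (\<forall>x\<in>ball p r. x \<in> \<Omega> \<longleftrightarrow> \<gamma> (x - (x \<bullet> e) *\<^sub>R e) < x \<bullet> e))"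

definition L2 :: "(real^'n) set \<Rightarrow> (real^'n \<Rightarrow> 'b::euclidean_space) \<Rightarrow> bool" where
  "L2 \<Omega> f \<longleftrightarrow>
     f \<in> borel_measurable (lebesgue_on \<Omega>) \<and> integrable (lebesgue_on \<Omega>) (\<lambda>x. (norm (f x))\<^sup>2)"

definition partial :: "'n \<Rightarrow> (real^'n \<Rightarrow> real) \<Rightarrow> real^'n \<Rightarrow> real" where
  "partial i f x = frechet_derivative f (at x) (axis i 1)"

definition gradient :: "(real^'n \<Rightarrow> real) \<Rightarrow> real^'n \<Rightarrow> real^'n" where
  "gradient f x = (\<chi> i. partial i f x)"

primrec Ck :: "nat \<Rightarrow> (real^'n \<Rightarrow> real) \<Rightarrow> bool" where
  "Ck 0 f \<longleftrightarrow> continuous_on UNIV f"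
| "Ck (Suc k) f \<longleftrightarrow> (\<forall>x. f differentiable (at x)) \<and> (\<forall>i. Ck k (partial i f))"

definition test_function :: "(real^'n) set \<Rightarrow> (real^'n \<Rightarrow> real) \<Rightarrow> bool" where
  "test_function \<Omega> \<phi> \<longleftrightarrow>
     (\<forall>k. Ck k \<phi>) \<and> compact (closure {x. \<phi> x \<noteq> 0}) \<and> closure {x. \<phi> x \<noteq> 0} \<subseteq> \<Omega>"

text \<open>
  Sobolev functions are represented by actual functions on \<open>\<real>\<^sup>n\<close> (only their values on \<open>\<Omega>\<close>
  matter).  As a weak gradient is only determined almost everywhere, it is treated relationally:
  \<open>g\<close> below is any representative of \<open>Dw\<close>.
\<close>

definition has_weak_gradient ::
    "(real^'n) set \<Rightarrow> (real^'n \<Rightarrow> real) \<Rightarrow> (real^'n \<Rightarrow> real^'n) \<Rightarrow> bool" where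
  "has_weak_gradient \<Omega> w g \<longleftrightarrow>
     (\<forall>K. compact K \<and> K \<subseteq> \<Omega> \<longrightarrow> set_integrable lebesgue K w \<and> set_integrable lebesgue K g) \<and>
     (\<forall>\<phi>. test_function \<Omega> \<phi> \<longrightarrow>
        (LINT x|lebesgue_on \<Omega>. w x *\<^sub>R gradient \<phi> x) = - (LINT x|lebesgue_on \<Omega>. \<phi> x *\<^sub>R g x))"

definition H1 :: "(real^'n) set \<Rightarrow> (real^'n \<Rightarrow> real) \<Rightarrow> (real^'n \<Rightarrow> real^'n) \<Rightarrow> bool" where
  "H1 \<Omega> w g \<longleftrightarrow> L2 \<Omega> w \<and> L2 \<Omega> g \<and> has_weak_gradient \<Omega> w g"

text \<open>\<open>H10 \<Omega> w g\<close>: \<open>w\<close> lies in \<open>H\<^sub>0\<^sup>1(\<Omega>)\<close>, the closure of the test functions in the norm of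
  \<open>H\<^sup>1(\<Omega>)\<close>, and has weak gradient \<open>g\<close>.\<close>

definition H10 :: "(real^'n) set \<Rightarrow> (real^'n \<Rightarrow> real) \<Rightarrow> (real^'n \<Rightarrow> real^'n) \<Rightarrow> bool" where
  "H10 \<Omega> w g \<longleftrightarrow> H1 \<Omega> w g \<and>
     (\<exists>\<phi> :: nat \<Rightarrow> real^'n \<Rightarrow> real. (\<forall>k. test_function \<Omega> (\<phi> k)) \<and>
        (\<lambda>k. LINT x|lebesgue_on \<Omega>. (w x - \<phi> k x)\<^sup>2) \<longlonglongrightarrow> 0 \<and>
        (\<lambda>k. LINT x|lebesgue_on \<Omega>. (norm (g x - gradient (\<phi> k) x))\<^sup>2) \<longlonglongrightarrow> 0)"

definition energy ::
    "(real^'n) set \<Rightarrow> (real^'n \<Rightarrow> real) \<Rightarrow> (real^'n \<Rightarrow> real) \<Rightarrow> (real^'n \<Rightarrow> real^'n) \<Rightarrow>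
     (real^'n \<Rightarrow> real) \<Rightarrow> (real^'n \<Rightarrow> real^'n) \<Rightarrow> real" where
  "energy \<Omega> a H F w Dw = (LINT x|lebesgue_on \<Omega>. a x * norm (Dw x + F x) + H x * w x)"

definition energy_minimizer ::
    "(real^'n) set \<Rightarrow> (real^'n \<Rightarrow> real) \<Rightarrow> (real^'n \<Rightarrow> real) \<Rightarrow> (real^'n \<Rightarrow> real^'n) \<Rightarrow>
     (real^'n \<Rightarrow> real) \<Rightarrow> (real^'n \<Rightarrow> real^'n) \<Rightarrow> bool" where
  "energy_minimizer \<Omega> a H F u Du \<longleftrightarrow>
     H10 \<Omega> u Du \<and> (\<forall>w Dw. H10 \<Omega> w Dw \<longrightarrow> energy \<Omega> a H F u Du \<le> energy \<Omega> a H F w Dw)"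

definition dual_admissible ::
    "(real^'n) set \<Rightarrow> (real^'n \<Rightarrow> real) \<Rightarrow> (real^'n \<Rightarrow> real) \<Rightarrow> (real^'n \<Rightarrow> real^'n) \<Rightarrow> bool" where
  "dual_admissible \<Omega> a H b \<longleftrightarrow>
     L2 \<Omega> b \<and> (AE x in lebesgue_on \<Omega>. norm (b x) \<le> a x) \<and>
     (\<forall>w Dw. H10 \<Omega> w Dw \<longrightarrow> (LINT x|lebesgue_on \<Omega>. Dw x \<bullet> b x + H x * w x) = 0)"

definition flux_field ::
    "(real^'n) set \<Rightarrow> (real^'n \<Rightarrow> real) \<Rightarrow> (real^'n \<Rightarrow> real) \<Rightarrow> (real^'n \<Rightarrow> real^'n) \<Rightarrow>
     (real^'n \<Rightarrow> real^'n) \<Rightarrow> bool" where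
  "flux_field \<Omega> a H F J \<longleftrightarrow>
     dual_admissible \<Omega> a H J \<and>
     (\<forall>b. dual_admissible \<Omega> a H b \<longrightarrow>
        (LINT x|lebesgue_on \<Omega>. F x \<bullet> b x) \<le> (LINT x|lebesgue_on \<Omega>. F x \<bullet> J x))"

text \<open>
  The coefficient \<open>\<sigma> = a / |Du + F|\<close>.  It is extended-real valued so that \<open>\<sigma> = \<infinity>\<close> where
  \<open>Du + F = 0\<close> (and \<open>a > 0\<close>); with real division an upper bound on \<open>\<sigma>\<close> would say nothing there.
  That \<open>J = \<sigma> (Du + F)\<close> wherever \<open>Du + F \<noteq> 0\<close> is a consequence of the optimality of \<open>u\<close> and \<open>J\<close>.
\<close>

definition conductivity ::
    "(real^'n \<Rightarrow> real) \<Rightarrow> (real^'n \<Rightarrow> real^'n) \<Rightarrow> (real^'n \<Rightarrow> real^'n) \<Rightarrow> real^'n \<Rightarrow> ereal" where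
  "conductivity a F Du x = ereal (a x) / ereal (norm (Du x + F x))"

lemma conductivity_eq_infinity:
  assumes "a x > 0" and "Du x + F x = 0"
  shows "conductivity a F Du x = \<infinity>"
  using assms by (simp add: conductivity_def divide_ereal_def)

end

theory Submission
  imports Defs
begin

text \<open>
  Put \<open>p = Du + F\<close>.  The bound on \<open>\<sigma>\<close> keeps \<open>p\<close> away from \<open>0\<close>, so the energy has a quadratic upper
  bound at \<open>u\<close> and minimality gives the Euler--Lagrange equation: \<open>a p / |p|\<close> is admissible for the
  dual problem.  Comparing \<open>J\<close> with it yields \<open>\<integral>F \<bullet> J \<ge> \<integral>(a |p| + H u)\<close>, hence, as \<open>J'\<close> is
  admissible, \<open>\<integral>F \<bullet> (J - J') \<ge> \<integral>(a |p| - p \<bullet> J')\<close> and \<open>J = a p / |p|\<close>.  The integrand on the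
  right is at least \<open>|J - J'|\<^sup>2 / (2 \<sigma>\<^sub>1)\<close>, while \<open>\<integral>F' \<bullet> (J - J') \<le> 0\<close> by optimality of \<open>J'\<close>, so
  \<open>\<integral>|J - J'|\<^sup>2 \<le> 2 \<sigma>\<^sub>1 \<integral>(F - F') \<bullet> (J - J') \<le> 4 M \<sigma>\<^sub>1 \<integral>|F - F'|\<close>.  The Cauchy--Schwarz inequality
  finishes the proof.  Using the optimality of \<open>J'\<close> in the dual problem, rather than its relation to
  \<open>u'\<close>, avoids strong duality where \<open>Du' + F'\<close> vanishes.
\<close>

section \<open>Square-integrable functions on a set of finite measure\<close>

lemma L2_add:
  assumes "L2 \<Omega> f" "L2 \<Omega> g"
  shows "L2 \<Omega> (\<lambda>x. f x + g x)"
proof -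
  have [measurable]: "f \<in> borel_measurable (lebesgue_on \<Omega>)" "g \<in> borel_measurable (lebesgue_on \<Omega>)"
    using assms by (auto simp: L2_def)
  have "integrable (lebesgue_on \<Omega>) (\<lambda>x. 2 * (norm (f x))\<^sup>2 + 2 * (norm (g x))\<^sup>2)"
    using assms by (auto simp: L2_def)
  then have "integrable (lebesgue_on \<Omega>) (\<lambda>x. (norm (f x + g x))\<^sup>2)"
  proof (rule Bochner_Integration.integrable_bound)
    show "AE x in lebesgue_on \<Omega>. norm ((norm (f x + g x))\<^sup>2)
            \<le> norm (2 * (norm (f x))\<^sup>2 + 2 * (norm (g x))\<^sup>2)"
    proof (rule AE_I2)
      fix x
      have "(norm (f x + g x))\<^sup>2 \<le> (norm (f x) + norm (g x))\<^sup>2"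
        by (intro power_mono norm_triangle_ineq) auto
      also have "\<dots> \<le> 2 * (norm (f x))\<^sup>2 + 2 * (norm (g x))\<^sup>2"
        using sum_squares_bound[of "norm (f x)" "norm (g x)"] by (simp add: power2_sum)
      finally show "norm ((norm (f x + g x))\<^sup>2) \<le> norm (2 * (norm (f x))\<^sup>2 + 2 * (norm (g x))\<^sup>2)"
        by simp
    qed
  qed measurable
  then show ?thesis by (simp add: L2_def)
qed

lemma L2_scaleR:
  assumes "L2 \<Omega> f"
  shows "L2 \<Omega> (\<lambda>x. c *\<^sub>R f x)"
proof -
  have "f \<in> borel_measurable (lebesgue_on \<Omega>)" "integrable (lebesgue_on \<Omega>) (\<lambda>x. (norm (f x))\<^sup>2)"
    using assms by (auto simp: L2_def)
  then show ?thesis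
    unfolding L2_def by (simp add: power_mult_distrib borel_measurable_scaleR)
qed

lemma L2_diff:
  assumes "L2 \<Omega> f" "L2 \<Omega> g"
  shows "L2 \<Omega> (\<lambda>x. f x - g x)"
  using L2_add[OF assms(1) L2_scaleR[OF assms(2), of "-1"]] by simp

lemma L2_norm:
  assumes "L2 \<Omega> f"
  shows "L2 \<Omega> (\<lambda>x. norm (f x))"
  using assms by (auto simp: L2_def)

text \<open>This follows from \<open>2 * r * s\<close> being at most the sum of the squares of
  \<open>r\<close> and \<open>s\<close>. As \<open>f\<close> and \<open>g\<close> may have different
  codomains, it covers both inner products and scalar multiples; with \<open>g\<close> constantly 1
  it shows that square integrability implies integrability on a set of finite measure.\<close>

lemma integrable_norm_mult_L2:
  assumes "L2 \<Omega> f" "L2 \<Omega> g"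
  shows "integrable (lebesgue_on \<Omega>) (\<lambda>x. norm (f x) * norm (g x))"
proof -
  have [measurable]: "f \<in> borel_measurable (lebesgue_on \<Omega>)" "g \<in> borel_measurable (lebesgue_on \<Omega>)"
    using assms by (auto simp: L2_def)
  have "integrable (lebesgue_on \<Omega>) (\<lambda>x. (norm (f x))\<^sup>2 + (norm (g x))\<^sup>2)"
    using assms by (auto simp: L2_def)
  then show ?thesis
  proof (rule Bochner_Integration.integrable_bound)
    show "AE x in lebesgue_on \<Omega>. norm (norm (f x) * norm (g x))
            \<le> norm ((norm (f x))\<^sup>2 + (norm (g x))\<^sup>2)"
    proof (rule AE_I2)
      fix x
      have "0 \<le> norm (f x) * norm (g x)" by simp
      then have "norm (f x) * norm (g x) \<le> (norm (f x))\<^sup>2 + (norm (g x))\<^sup>2"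
        using sum_squares_bound[of "norm (f x)" "norm (g x)"] by linarith
      then show "norm (norm (f x) * norm (g x)) \<le> norm ((norm (f x))\<^sup>2 + (norm (g x))\<^sup>2)"
        by simp
    qed
  qed measurable
qed

lemma integrable_inner_L2:
  assumes "L2 \<Omega> f" "L2 \<Omega> g"
  shows "integrable (lebesgue_on \<Omega>) (\<lambda>x. f x \<bullet> g x)"
proof (rule Bochner_Integration.integrable_bound[OF integrable_norm_mult_L2[OF assms]])
  show "(\<lambda>x. f x \<bullet> g x) \<in> borel_measurable (lebesgue_on \<Omega>)"
    using assms by (intro borel_measurable_inner) (auto simp: L2_def)
qed (simp add: Cauchy_Schwarz_ineq2)

lemma integrable_scaleR_L2:
  assumes "L2 \<Omega> f" "L2 \<Omega> g"
  shows "integrable (lebesgue_on \<Omega>) (\<lambda>x. f x *\<^sub>R g x)"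
proof (rule Bochner_Integration.integrable_bound[OF integrable_norm_mult_L2[OF assms]])
  show "(\<lambda>x. f x *\<^sub>R g x) \<in> borel_measurable (lebesgue_on \<Omega>)"
    using assms by (intro borel_measurable_scaleR) (auto simp: L2_def)
qed simp

lemma L2_bounded:
  assumes "\<Omega> \<in> lmeasurable" "f \<in> borel_measurable (lebesgue_on \<Omega>)"
    and bound: "AE x in lebesgue_on \<Omega>. norm (f x) \<le> C"
  shows "L2 \<Omega> f"
proof -
  interpret finite_measure "lebesgue_on \<Omega>"
    using assms(1) by (rule finite_measure_lebesgue_on)
  have "integrable (lebesgue_on \<Omega>) (\<lambda>x. (norm (f x))\<^sup>2)"
  proof (rule integrable_const_bound[where B = "C\<^sup>2"])
    show "AE x in lebesgue_on \<Omega>. norm ((norm (f x))\<^sup>2) \<le> C\<^sup>2"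
      using bound by eventually_elim (simp add: power_mono)
  qed (use assms(2) in measurable)
  with assms(2) show ?thesis by (simp add: L2_def)
qed

text \<open>A continuous function is bounded on the compact closure of \<Omega>. This puts test
  functions and their gradients into \<open>L2\<close>.\<close>

lemma L2_continuous:
  assumes "open \<Omega>" "bounded \<Omega>" "continuous_on UNIV f"
  shows "L2 \<Omega> f"
proof -
  have "compact (f ` closure \<Omega>)"
    using assms by (intro compact_continuous_image)
      (auto simp: compact_closure intro: continuous_on_subset)
  then have "bounded (f ` closure \<Omega>)" by (rule compact_imp_bounded)
  then obtain C where C: "\<forall>x\<in>closure \<Omega>. norm (f x) \<le> C"
    by (auto simp: bounded_iff)
  show ?thesis
  proof (rule L2_bounded[where C = C])
    show "\<Omega> \<in> lmeasurable" using assms by (simp add: lmeasurable_open)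
    show "f \<in> borel_measurable (lebesgue_on \<Omega>)"
      using assms by (intro continuous_imp_measurable_on_sets_lebesgue)
        (auto intro: continuous_on_subset)
    show "AE x in lebesgue_on \<Omega>. norm (f x) \<le> C"
      by (rule AE_I2) (use C closure_subset in \<open>auto simp: space_restrict_space\<close>)
  qed
qed

text \<open>The Cauchy-Schwarz inequality for \<open>norm (f x)\<close> and the constant 1, obtained
  from the nonnegative variance of \<open>norm (f x)\<close>.\<close>

lemma L2_norm_integral_power2_le:
  assumes "\<Omega> \<in> lmeasurable" "L2 \<Omega> f"
  shows "(LINT x|lebesgue_on \<Omega>. norm (f x))\<^sup>2
           \<le> measure lebesgue \<Omega> * (LINT x|lebesgue_on \<Omega>. (norm (f x))\<^sup>2)"
proof -
  interpret finite_measure "lebesgue_on \<Omega>"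
    using assms(1) by (rule finite_measure_lebesgue_on)
  define V where "V = measure lebesgue \<Omega>"
  define A where "A = (LINT x|lebesgue_on \<Omega>. norm (f x))"
  define S where "S = (LINT x|lebesgue_on \<Omega>. (norm (f x))\<^sup>2)"
  have V: "measure (lebesgue_on \<Omega>) \<Omega> = V"
    using assms(1) by (simp add: V_def measure_restrict_space fmeasurableD)
  have sq: "integrable (lebesgue_on \<Omega>) (\<lambda>x. (norm (f x))\<^sup>2)"
    using assms by (simp add: L2_def)
  have int: "integrable (lebesgue_on \<Omega>) (\<lambda>x. norm (f x))"
    using integrable_norm_mult_L2[OF assms(2) L2_bounded[OF assms(1), of "\<lambda>x. 1::real" 1]] by simp
  \<comment> \<open>The deviation of \<open>norm (f x)\<close> from its mean \<open>A / V\<close> is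
    multiplied by \<open>V\<close>, so that no division occurs and \<open>V = 0\<close> need not yet
    be excluded.\<close>
  have "0 \<le> (LINT x|lebesgue_on \<Omega>. (V * norm (f x) - A)\<^sup>2)"
    by simp
  also have "\<dots> = (LINT x|lebesgue_on \<Omega>. V\<^sup>2 * (norm (f x))\<^sup>2 - 2 * V * A * norm (f x) + A\<^sup>2)"
    by (rule Bochner_Integration.integral_cong) (auto simp: power2_diff power_mult_distrib)
  also have "\<dots> = V\<^sup>2 * S - 2 * V * A * A + V * A\<^sup>2"
    using sq int by (simp add: V A_def S_def)
  also have "\<dots> = V * (V * S - A\<^sup>2)"
    by (simp add: power2_eq_square algebra_simps)
  finally have nonneg: "0 \<le> V * (V * S - A\<^sup>2)" .
  have "V \<ge> 0" by (simp add: V_def)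
  show ?thesis
  \<comment> \<open>The factor \<open>V\<close> can be cancelled only if it is positive; otherwise
    \<Omega> is a null set and both sides vanish.\<close>
  proof (cases "V = 0")
    case True
    then have "emeasure (lebesgue_on \<Omega>) (space (lebesgue_on \<Omega>)) = 0"
      using V by (simp add: emeasure_eq_measure)
    then have "space (lebesgue_on \<Omega>) \<in> null_sets (lebesgue_on \<Omega>)"
      by (intro null_setsI) auto
    then have "AE x in lebesgue_on \<Omega>. norm (f x) = 0"
      by (rule AE_I') auto
    then have "A = 0"
      unfolding A_def by (rule integral_eq_zero_AE)
    then show ?thesis using True by (simp flip: V_def A_def)
  next
    case False
    with \<open>V \<ge> 0\<close> have "V > 0" by simp
    with nonneg have "A\<^sup>2 \<le> V * S" by (simp add: zero_le_mult_iff)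
    then show ?thesis by (simp add: V_def A_def S_def)
  qed
qed

text \<open>The squared norm of a sum is at most twice the sum of the squared norms, so the
  integrals are squeezed to 0. The lemma serves to combine two approximating sequences of test
  functions.\<close>

lemma L2_tendsto_zero_add_scaleR:
  assumes "\<And>k. L2 \<Omega> (f k)" "\<And>k. L2 \<Omega> (g k)"
    and "(\<lambda>k. LINT x|lebesgue_on \<Omega>. (norm (f k x))\<^sup>2) \<longlonglongrightarrow> 0"
    and "(\<lambda>k. LINT x|lebesgue_on \<Omega>. (norm (g k x))\<^sup>2) \<longlonglongrightarrow> 0"
  shows "(\<lambda>k. LINT x|lebesgue_on \<Omega>. (norm (f k x + t *\<^sub>R g k x))\<^sup>2) \<longlonglongrightarrow> 0"
proof (rule tendsto_sandwich[where f = "\<lambda>_. 0"])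
  have bound: "(LINT x|lebesgue_on \<Omega>. (norm (f k x + t *\<^sub>R g k x))\<^sup>2)
      \<le> 2 * (LINT x|lebesgue_on \<Omega>. (norm (f k x))\<^sup>2)
        + 2 * t\<^sup>2 * (LINT x|lebesgue_on \<Omega>. (norm (g k x))\<^sup>2)" for k
  proof -
    have int: "integrable (lebesgue_on \<Omega>) (\<lambda>x. (norm (f k x))\<^sup>2)"
        "integrable (lebesgue_on \<Omega>) (\<lambda>x. (norm (g k x))\<^sup>2)"
      using assms(1,2)[of k] by (auto simp: L2_def)
    have "(LINT x|lebesgue_on \<Omega>. (norm (f k x + t *\<^sub>R g k x))\<^sup>2)
       \<le> (LINT x|lebesgue_on \<Omega>. 2 * (norm (f k x))\<^sup>2 + 2 * t\<^sup>2 * (norm (g k x))\<^sup>2)"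
    proof (rule Bochner_Integration.integral_mono)
      show "integrable (lebesgue_on \<Omega>) (\<lambda>x. (norm (f k x + t *\<^sub>R g k x))\<^sup>2)"
        using L2_add[OF assms(1) L2_scaleR[OF assms(2)], of k t k] by (simp add: L2_def)
      show "integrable (lebesgue_on \<Omega>) (\<lambda>x. 2 * (norm (f k x))\<^sup>2 + 2 * t\<^sup>2 * (norm (g k x))\<^sup>2)"
        using int by simp
      fix x
      have "(norm (f k x + t *\<^sub>R g k x))\<^sup>2 \<le> (norm (f k x) + norm (t *\<^sub>R g k x))\<^sup>2"
        by (intro power_mono norm_triangle_ineq) auto
      also have "\<dots> \<le> 2 * (norm (f k x))\<^sup>2 + 2 * (norm (t *\<^sub>R g k x))\<^sup>2"
        using sum_squares_bound[of "norm (f k x)" "norm (t *\<^sub>R g k x)"] by (simp add: power2_sum)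
      finally show "(norm (f k x + t *\<^sub>R g k x))\<^sup>2 \<le> 2 * (norm (f k x))\<^sup>2 + 2 * t\<^sup>2 * (norm (g k x))\<^sup>2"
        by (simp add: power_mult_distrib)
    qed
    also have "\<dots> = 2 * (LINT x|lebesgue_on \<Omega>. (norm (f k x))\<^sup>2)
        + 2 * t\<^sup>2 * (LINT x|lebesgue_on \<Omega>. (norm (g k x))\<^sup>2)"
      using int by simp
    finally show ?thesis .
  qed
  show "\<forall>\<^sub>F k in sequentially. (LINT x|lebesgue_on \<Omega>. (norm (f k x + t *\<^sub>R g k x))\<^sup>2)
      \<le> 2 * (LINT x|lebesgue_on \<Omega>. (norm (f k x))\<^sup>2)
        + 2 * t\<^sup>2 * (LINT x|lebesgue_on \<Omega>. (norm (g k x))\<^sup>2)"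
    using bound by simp
  show "(\<lambda>k. 2 * (LINT x|lebesgue_on \<Omega>. (norm (f k x))\<^sup>2)
        + 2 * t\<^sup>2 * (LINT x|lebesgue_on \<Omega>. (norm (g k x))\<^sup>2)) \<longlonglongrightarrow> 0"
    using tendsto_add[OF tendsto_mult_left[OF assms(3), of 2] tendsto_mult_left[OF assms(4), of "2 * t\<^sup>2"]]
    by simp
qed (auto intro!: tendsto_const)

section \<open>Linear combinations of test functions and of elements of \<open>H10\<close>\<close>

lemma partial_add_scale:
  assumes "f differentiable (at x)" "g differentiable (at x)"
  shows "partial i (\<lambda>x. f x + t * g x) x = partial i f x + t * partial i g x"
proof -
  have "((\<lambda>x. f x + t * g x) has_derivative
      (\<lambda>h. frechet_derivative f (at x) h + t * frechet_derivative g (at x) h)) (at x)"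
    using assms by (intro has_derivative_add has_derivative_mult_right)
      (auto simp: frechet_derivative_works)
  then show ?thesis
    unfolding partial_def by (simp add: frechet_derivative_at[symmetric])
qed

text \<open>The induction keeps \<open>f\<close> and \<open>g\<close> arbitrary because its
  hypothesis is applied to their partial derivatives.\<close>

lemma Ck_add_scale:
  assumes "Ck k f" "Ck k g"
  shows "Ck k (\<lambda>x. f x + t * g x)"
  using assms
proof (induction k arbitrary: f g)
  case 0
  then show ?case by (auto intro!: continuous_intros)
next
  case (Suc k)
  then have diff: "\<And>x. f differentiable (at x)" "\<And>x. g differentiable (at x)" by auto
  have "partial i (\<lambda>x. f x + t * g x) = (\<lambda>x. partial i f x + t * partial i g x)" for i
    by (rule ext) (rule partial_add_scale[OF diff])
  with Suc diff show ?case
    by (auto intro!: differentiable_add differentiable_mult)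
qed

lemma test_function_differentiable:
  assumes "test_function \<Omega> \<phi>"
  shows "\<phi> differentiable (at x)"
proof -
  have "Ck (Suc 0) \<phi>" using assms unfolding test_function_def by blast
  then show ?thesis by simp
qed

lemma continuous_on_test_function:
  assumes "test_function \<Omega> \<phi>"
  shows "continuous_on UNIV \<phi>"
proof -
  have "Ck 0 \<phi>" using assms unfolding test_function_def by blast
  then show ?thesis by simp
qed

lemma continuous_on_gradient_test_function:
  assumes "test_function \<Omega> \<phi>"
  shows "continuous_on UNIV (gradient \<phi>)"
proof -
  have "Ck (Suc 0) \<phi>" using assms unfolding test_function_def by blast
  then have "continuous_on UNIV (partial i \<phi>)" for i by simp
  then show ?thesis
    unfolding gradient_def by (intro continuous_on_vec_lambda)
qed

lemma gradient_add_scale: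
  assumes "test_function \<Omega> \<phi>" "test_function \<Omega> \<psi>"
  shows "gradient (\<lambda>x. \<phi> x + t * \<psi> x) x = gradient \<phi> x + t *\<^sub>R gradient \<psi> x"
  using assms by (simp add: gradient_def vec_eq_iff partial_add_scale test_function_differentiable)

lemma test_function_add_scale:
  assumes "test_function \<Omega> \<phi>" "test_function \<Omega> \<psi>"
  shows "test_function \<Omega> (\<lambda>x. \<phi> x + t * \<psi> x)"
proof -
  let ?S = "closure {x. \<phi> x \<noteq> 0} \<union> closure {x. \<psi> x \<noteq> 0}"
  have S: "compact ?S" "?S \<subseteq> \<Omega>"
    using assms by (auto simp: test_function_def)
  have "closure {x. \<phi> x + t * \<psi> x \<noteq> 0} \<subseteq> closure ({x. \<phi> x \<noteq> 0} \<union> {x. \<psi> x \<noteq> 0})"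
    by (rule closure_mono) auto
  then have sub: "closure {x. \<phi> x + t * \<psi> x \<noteq> 0} \<subseteq> ?S"
    by (simp add: closure_Un)
  then have "compact (closure {x. \<phi> x + t * \<psi> x \<noteq> 0})"
    using S(1) by (meson closed_closure compact_closure bounded_subset compact_imp_bounded
        closure_subset order_trans)
  with S(2) sub assms show ?thesis
    unfolding test_function_def by (auto intro: Ck_add_scale)
qed

text \<open>Both sides of the integration by parts formula are linear in the function and its weak
  gradient. All products that occur are integrable, having two factors in \<open>L2\<close>, so the
  integrals may be split.\<close>

lemma has_weak_gradient_add_scale:
  assumes \<Omega>: "open \<Omega>" "bounded \<Omega>"
    and "H1 \<Omega> u Du" "H1 \<Omega> w Dw"
  shows "has_weak_gradient \<Omega> (\<lambda>x. u x + t * w x) (\<lambda>x. Du x + t *\<^sub>R Dw x)"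
  unfolding has_weak_gradient_def
proof (intro conjI allI impI)
  have wg: "has_weak_gradient \<Omega> u Du" "has_weak_gradient \<Omega> w Dw"
    using assms by (auto simp: H1_def)
  have l2: "L2 \<Omega> u" "L2 \<Omega> Du" "L2 \<Omega> w" "L2 \<Omega> Dw"
    using assms by (auto simp: H1_def)
  {
    fix K assume "compact K \<and> K \<subseteq> \<Omega>"
    with wg have loc: "set_integrable lebesgue K u" "set_integrable lebesgue K Du"
        "set_integrable lebesgue K w" "set_integrable lebesgue K Dw"
      by (auto simp: has_weak_gradient_def)
    show "set_integrable lebesgue K (\<lambda>x. u x + t * w x)"
      using loc by (intro set_integral_add(1) set_integrable_mult_right) auto
    show "set_integrable lebesgue K (\<lambda>x. Du x + t *\<^sub>R Dw x)"
      using loc by (intro set_integral_add(1) set_integrable_scaleR_right) auto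
  next
    fix \<phi> assume \<phi>: "test_function \<Omega> \<phi>"
    have \<phi>2: "L2 \<Omega> \<phi>" "L2 \<Omega> (gradient \<phi>)"
      using \<phi> by (auto intro!: L2_continuous[OF \<Omega>] continuous_on_test_function
          continuous_on_gradient_test_function)
    have int: "integrable (lebesgue_on \<Omega>) (\<lambda>x. u x *\<^sub>R gradient \<phi> x)"
        "integrable (lebesgue_on \<Omega>) (\<lambda>x. w x *\<^sub>R gradient \<phi> x)"
        "integrable (lebesgue_on \<Omega>) (\<lambda>x. \<phi> x *\<^sub>R Du x)"
        "integrable (lebesgue_on \<Omega>) (\<lambda>x. \<phi> x *\<^sub>R Dw x)"
      using l2 \<phi>2 by (auto intro: integrable_scaleR_L2)
    have "(LINT x|lebesgue_on \<Omega>. (u x + t * w x) *\<^sub>R gradient \<phi> x)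
        = (LINT x|lebesgue_on \<Omega>. u x *\<^sub>R gradient \<phi> x + t *\<^sub>R (w x *\<^sub>R gradient \<phi> x))"
      by (simp add: algebra_simps)
    also have "\<dots> = (LINT x|lebesgue_on \<Omega>. u x *\<^sub>R gradient \<phi> x)
        + t *\<^sub>R (LINT x|lebesgue_on \<Omega>. w x *\<^sub>R gradient \<phi> x)"
      using int by (subst Bochner_Integration.integral_add) (simp_all del: scaleR_scaleR)
    also have "\<dots> = - (LINT x|lebesgue_on \<Omega>. \<phi> x *\<^sub>R Du x)
        - t *\<^sub>R (LINT x|lebesgue_on \<Omega>. \<phi> x *\<^sub>R Dw x)"
      using wg \<phi> by (simp add: has_weak_gradient_def)
    also have "\<dots> = - (LINT x|lebesgue_on \<Omega>. \<phi> x *\<^sub>R Du x + t *\<^sub>R (\<phi> x *\<^sub>R Dw x))"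
      using int by (subst Bochner_Integration.integral_add) (simp_all del: scaleR_scaleR)
    also have "\<dots> = - (LINT x|lebesgue_on \<Omega>. \<phi> x *\<^sub>R (Du x + t *\<^sub>R Dw x))"
      by (simp add: algebra_simps)
    finally show "(LINT x|lebesgue_on \<Omega>. (u x + t * w x) *\<^sub>R gradient \<phi> x)
        = - (LINT x|lebesgue_on \<Omega>. \<phi> x *\<^sub>R (Du x + t *\<^sub>R Dw x))" .
  }
qed

text \<open>If \<open>\<phi> k\<close> approximates \<open>u\<close> and \<open>\<psi> k\<close>
  approximates \<open>w\<close>, then \<open>\<phi> k + t * \<psi> k\<close> approximates the
  combination. This makes \<open>u + t * w\<close> a competitor in the minimization problem for
  every real \<open>t\<close>.\<close>

lemma H10_add_scale:
  assumes \<Omega>: "open \<Omega>" "bounded \<Omega>"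
    and u: "H10 \<Omega> u Du" and w: "H10 \<Omega> w Dw"
  shows "H10 \<Omega> (\<lambda>x. u x + t * w x) (\<lambda>x. Du x + t *\<^sub>R Dw x)"
proof -
  have h1: "H1 \<Omega> u Du" "H1 \<Omega> w Dw" using u w by (auto simp: H10_def)
  then have l2: "L2 \<Omega> u" "L2 \<Omega> Du" "L2 \<Omega> w" "L2 \<Omega> Dw" by (auto simp: H1_def)
  have "H1 \<Omega> (\<lambda>x. u x + t * w x) (\<lambda>x. Du x + t *\<^sub>R Dw x)"
    unfolding H1_def
    using has_weak_gradient_add_scale[OF \<Omega> h1] L2_add[OF l2(1) L2_scaleR[OF l2(3), of t]]
      L2_add[OF l2(2) L2_scaleR[OF l2(4), of t]] by simp
  moreover
  obtain \<phi> where \<phi>: "\<And>k. test_function \<Omega> (\<phi> k)"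
      "(\<lambda>k. LINT x|lebesgue_on \<Omega>. (u x - \<phi> k x)\<^sup>2) \<longlonglongrightarrow> 0"
      "(\<lambda>k. LINT x|lebesgue_on \<Omega>. (norm (Du x - gradient (\<phi> k) x))\<^sup>2) \<longlonglongrightarrow> 0"
    using u by (auto simp: H10_def)
  obtain \<psi> where \<psi>: "\<And>k. test_function \<Omega> (\<psi> k)"
      "(\<lambda>k. LINT x|lebesgue_on \<Omega>. (w x - \<psi> k x)\<^sup>2) \<longlonglongrightarrow> 0"
      "(\<lambda>k. LINT x|lebesgue_on \<Omega>. (norm (Dw x - gradient (\<psi> k) x))\<^sup>2) \<longlonglongrightarrow> 0"
    using w by (auto simp: H10_def)
  have test2: "L2 \<Omega> (\<phi> k)" "L2 \<Omega> (\<psi> k)" "L2 \<Omega> (gradient (\<phi> k))" "L2 \<Omega> (gradient (\<psi> k))" for k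
    using \<phi>(1) \<psi>(1) by (auto intro!: L2_continuous[OF \<Omega>] continuous_on_test_function
        continuous_on_gradient_test_function)
  have "(\<lambda>k. LINT x|lebesgue_on \<Omega>. (u x + t * w x - (\<phi> k x + t * \<psi> k x))\<^sup>2) \<longlonglongrightarrow> 0"
    using L2_tendsto_zero_add_scaleR[of \<Omega> "\<lambda>k x. u x - \<phi> k x" "\<lambda>k x. w x - \<psi> k x" t]
      l2 test2 \<phi>(2) \<psi>(2) by (simp add: L2_diff algebra_simps)
  moreover have "(\<lambda>k. LINT x|lebesgue_on \<Omega>.
      (norm (Du x + t *\<^sub>R Dw x - gradient (\<lambda>x. \<phi> k x + t * \<psi> k x) x))\<^sup>2) \<longlonglongrightarrow> 0"
    using L2_tendsto_zero_add_scaleR[of \<Omega> "\<lambda>k x. Du x - gradient (\<phi> k) x"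
        "\<lambda>k x. Dw x - gradient (\<psi> k) x" t] l2 test2 \<phi>(3) \<psi>(3)
    by (simp add: L2_diff gradient_add_scale[OF \<phi>(1) \<psi>(1)] algebra_simps)
  ultimately show ?thesis
    unfolding H10_def using test_function_add_scale[OF \<phi>(1) \<psi>(1)]
    by (intro conjI exI[of _ "\<lambda>k x. \<phi> k x + t * \<psi> k x"]) auto
qed

section \<open>The Euler-Lagrange equation of the energy\<close>

text \<open>The inequality between \<open>2 * r * s\<close> and the sum of squares, with
  \<open>r = norm p\<close> and \<open>s = norm (p + q)\<close>, is divided by
  \<open>2 * norm p\<close>. The result is the tangent to the norm at \<open>p\<close> plus a
  quadratic error.\<close>

lemma norm_add_le_quadratic:
  fixes p q :: "'a::real_inner"
  assumes "p \<noteq> 0"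
  shows "norm (p + q) \<le> norm p + p \<bullet> q / norm p + (norm q)\<^sup>2 / (2 * norm p)"
proof -
  have "2 * norm p * norm (p + q) \<le> (norm p)\<^sup>2 + (norm (p + q))\<^sup>2"
    by (rule sum_squares_bound)
  also have "\<dots> = 2 * (norm p)\<^sup>2 + 2 * (p \<bullet> q) + (norm q)\<^sup>2"
    by (simp add: power2_norm_eq_inner inner_add inner_commute)
  finally have "norm (p + q) \<le> (2 * (norm p)\<^sup>2 + 2 * (p \<bullet> q) + (norm q)\<^sup>2) / (2 * norm p)"
    using assms by (simp add: pos_le_divide_eq mult.commute)
  also have "\<dots> = norm p + p \<bullet> q / norm p + (norm q)\<^sup>2 / (2 * norm p)"
    using assms by (simp add: add_divide_distrib power2_eq_square)
  finally show ?thesis .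
qed

text \<open>For small \<open>t\<close> of sign opposite to \<open>L\<close> the linear term would
  dominate and make the sum negative.\<close>

lemma linear_coefficient_eq_0:
  fixes L C :: real
  assumes "\<And>t. 0 \<le> t * L + t\<^sup>2 * C"
  shows "L = 0"
proof (rule ccontr)
  assume "L \<noteq> 0"
  \<comment> \<open>\<open>D\<close> exceeds both 0 and \<open>C\<close>, so
    \<open>t = - L / D\<close> is a small enough step to give a negative value.\<close>
  define D where "D = \<bar>C\<bar> + 1"
  have "D > 0" "C < D" by (auto simp: D_def)
  have "0 \<le> (- L / D) * L + (- L / D)\<^sup>2 * C" by (rule assms)
  also have "\<dots> = L\<^sup>2 * (C - D) / D\<^sup>2"
    using \<open>D > 0\<close> by (simp add: field_simps power2_eq_square)
  also have "\<dots> < 0"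
    using \<open>L \<noteq> 0\<close> \<open>D > 0\<close> \<open>C < D\<close> by (intro divide_neg_pos mult_pos_neg) auto
  finally show False by simp
qed

text \<open>A finite bound excludes the value \<infinity>, which the extended-real quotient takes
  where \<open>Du + F\<close> vanishes; elsewhere it is the real quotient.\<close>

lemma conductivity_leD:
  assumes "a x > 0" "conductivity a F Du x \<le> ereal s"
  shows "Du x + F x \<noteq> 0" "a x / norm (Du x + F x) \<le> s"
proof -
  show "Du x + F x \<noteq> 0"
    using assms conductivity_eq_infinity[of a x Du F] by auto
  then show "a x / norm (Du x + F x) \<le> s"
    using assms(2) by (simp add: conductivity_def)
qed

text \<open>Passing from \<open>u\<close> to \<open>u + t * w\<close> raises the energy by at most a
  linear term in \<open>t\<close>, whose coefficient is the dual constraint tested with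
  \<open>w\<close>, plus a quadratic term. Minimality for \<open>t\<close> of both signs forces the
  linear coefficient to vanish.\<close>

lemma energy_minimizer_dual_admissible:
  assumes \<Omega>: "open \<Omega>" "bounded \<Omega>"
    and a [measurable]: "a \<in> borel_measurable (lebesgue_on \<Omega>)"
    and bounds: "AE x in lebesgue_on \<Omega>. 0 < a x \<and> a x \<le> M"
    and H: "L2 \<Omega> H" and F: "L2 \<Omega> F"
    and min: "energy_minimizer \<Omega> a H F u Du"
    and cond: "AE x in lebesgue_on \<Omega>. conductivity a F Du x \<le> ereal s"
  shows "dual_admissible \<Omega> a H (\<lambda>x. (a x / norm (Du x + F x)) *\<^sub>R (Du x + F x))"
proof -
  define p where "p = (\<lambda>x. Du x + F x)"
  define b where "b = (\<lambda>x. (a x / norm (p x)) *\<^sub>R p x)"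
  have u: "H10 \<Omega> u Du" using min by (simp add: energy_minimizer_def)
  then have l2u: "L2 \<Omega> u" "L2 \<Omega> Du" by (auto simp: H10_def H1_def)
  have p: "L2 \<Omega> p" unfolding p_def by (rule L2_add[OF l2u(2) F])
  then have [measurable]: "p \<in> borel_measurable (lebesgue_on \<Omega>)" by (simp add: L2_def)
  have \<Omega>m: "\<Omega> \<in> lmeasurable" using \<Omega> by (simp add: lmeasurable_open)
  \<comment> \<open>Where \<open>p x = 0\<close>, division by zero yields 0 and \<open>b x\<close>
    vanishes, so the bound holds there too.\<close>
  have nb: "AE x in lebesgue_on \<Omega>. norm (b x) \<le> a x"
    using bounds by eventually_elim (simp add: b_def)
  have bL2: "L2 \<Omega> b"
  proof (rule L2_bounded[OF \<Omega>m])
    show "b \<in> borel_measurable (lebesgue_on \<Omega>)" unfolding b_def by measurable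
    show "AE x in lebesgue_on \<Omega>. norm (b x) \<le> M"
      using nb bounds by eventually_elim simp
  qed
  have aL2: "L2 \<Omega> a"
    by (rule L2_bounded[OF \<Omega>m a, of M]) (use bounds in eventually_elim, simp)
  have split: "(LINT x|lebesgue_on \<Omega>. f x + c * g x + d * h x) = (LINT x|lebesgue_on \<Omega>. f x)
      + c * (LINT x|lebesgue_on \<Omega>. g x) + d * (LINT x|lebesgue_on \<Omega>. h x)"
    if "integrable (lebesgue_on \<Omega>) f" "integrable (lebesgue_on \<Omega>) g"
      "integrable (lebesgue_on \<Omega>) h" for f g h and c d :: real
    using that by simp
  have "(LINT x|lebesgue_on \<Omega>. Dw x \<bullet> b x + H x * w x) = 0" if w: "H10 \<Omega> w Dw" for w Dw
  proof (rule linear_coefficient_eq_0)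
    \<comment> \<open>The quadratic coefficient will be \<open>s / 2\<close> times the integral of
      \<open>(norm (Dw x))\<^sup>2\<close>.\<close>
    fix t :: real
    have l2w: "L2 \<Omega> w" "L2 \<Omega> Dw" using w by (auto simp: H10_def H1_def)
    have wt: "H10 \<Omega> (\<lambda>x. u x + t * w x) (\<lambda>x. Du x + t *\<^sub>R Dw x)"
      by (rule H10_add_scale[OF \<Omega> u w])
    then have l2t: "L2 \<Omega> (\<lambda>x. u x + t * w x)" "L2 \<Omega> (\<lambda>x. Du x + t *\<^sub>R Dw x)"
      by (auto simp: H10_def H1_def)
    have i1: "integrable (lebesgue_on \<Omega>) (\<lambda>x. a x * norm (p x) + H x * u x)"
      using integrable_inner_L2[OF aL2 L2_norm[OF p]] integrable_inner_L2[OF H l2u(1)] by simp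
    have i2: "integrable (lebesgue_on \<Omega>) (\<lambda>x. Dw x \<bullet> b x + H x * w x)"
      using integrable_inner_L2[OF l2w(2) bL2] integrable_inner_L2[OF H l2w(1)] by simp
    have i3: "integrable (lebesgue_on \<Omega>) (\<lambda>x. (norm (Dw x))\<^sup>2)"
      using l2w by (simp add: L2_def)
    have i4: "integrable (lebesgue_on \<Omega>)
        (\<lambda>x. a x * norm (Du x + t *\<^sub>R Dw x + F x) + H x * (u x + t * w x))"
      using integrable_inner_L2[OF aL2 L2_norm[OF L2_add[OF l2t(2) F]]]
        integrable_inner_L2[OF H l2t(1)] by simp
    have "energy \<Omega> a H F u Du \<le> energy \<Omega> a H F (\<lambda>x. u x + t * w x) (\<lambda>x. Du x + t *\<^sub>R Dw x)"
      using min wt by (simp add: energy_minimizer_def)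
    also have "\<dots> \<le> (LINT x|lebesgue_on \<Omega>. (a x * norm (p x) + H x * u x)
        + t * (Dw x \<bullet> b x + H x * w x) + t\<^sup>2 * s / 2 * (norm (Dw x))\<^sup>2)"
      unfolding energy_def
    proof (rule integral_mono_AE[OF i4])
      show "integrable (lebesgue_on \<Omega>) (\<lambda>x. (a x * norm (p x) + H x * u x)
          + t * (Dw x \<bullet> b x + H x * w x) + t\<^sup>2 * s / 2 * (norm (Dw x))\<^sup>2)"
        by (rule Bochner_Integration.integrable_add[OF Bochner_Integration.integrable_add[OF i1
              integrable_mult_right[OF i2]] integrable_mult_right[OF i3]])
      show "AE x in lebesgue_on \<Omega>.
          a x * norm (Du x + t *\<^sub>R Dw x + F x) + H x * (u x + t * w x)
          \<le> (a x * norm (p x) + H x * u x)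
            + t * (Dw x \<bullet> b x + H x * w x) + t\<^sup>2 * s / 2 * (norm (Dw x))\<^sup>2"
        using bounds cond
      proof eventually_elim
        case (elim x)
        then have p0: "p x \<noteq> 0" and s: "a x / norm (p x) \<le> s"
          using conductivity_leD[of a x F Du s] by (auto simp: p_def)
        have "a x * norm (p x + t *\<^sub>R Dw x)
            \<le> a x * (norm (p x) + p x \<bullet> (t *\<^sub>R Dw x) / norm (p x)
                + (norm (t *\<^sub>R Dw x))\<^sup>2 / (2 * norm (p x)))"
          using elim by (intro mult_left_mono norm_add_le_quadratic[OF p0]) auto
        also have "\<dots> = a x * norm (p x) + t * (Dw x \<bullet> b x)
            + (a x / norm (p x)) * (t\<^sup>2 * (norm (Dw x))\<^sup>2 / 2)"
          using p0 by (simp add: b_def field_simps inner_commute power_mult_distrib)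
        \<comment> \<open>The bound on the conductivity replaces \<open>a x / norm (p x)\<close> by
          the constant \<open>s\<close>, which makes the quadratic error integrable.\<close>
        also have "\<dots> \<le> a x * norm (p x) + t * (Dw x \<bullet> b x) + s * (t\<^sup>2 * (norm (Dw x))\<^sup>2 / 2)"
          using s by (intro add_left_mono mult_right_mono) auto
        finally show ?case
          by (simp add: p_def algebra_simps)
      qed
    qed
    also have "\<dots> = energy \<Omega> a H F u Du + t * (LINT x|lebesgue_on \<Omega>. Dw x \<bullet> b x + H x * w x)
        + t\<^sup>2 * s / 2 * (LINT x|lebesgue_on \<Omega>. (norm (Dw x))\<^sup>2)"
      using split[OF i1 i2 i3, of t "t\<^sup>2 * s / 2"] by (simp only: energy_def p_def)
    finally show "0 \<le> t * (LINT x|lebesgue_on \<Omega>. Dw x \<bullet> b x + H x * w x)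
        + t\<^sup>2 * (s / 2 * (LINT x|lebesgue_on \<Omega>. (norm (Dw x))\<^sup>2))"
      by simp
  qed
  with bL2 nb have "dual_admissible \<Omega> a H b" by (simp add: dual_admissible_def)
  then show ?thesis by (simp add: b_def p_def)
qed

section \<open>Comparison of admissible fields in the dual problem\<close>

text \<open>The constraint tested with \<open>u\<close> gives the integral of
  \<open>Du x \<bullet> d x\<close> the value minus the integral of \<open>H x * u x\<close> for
  every admissible \<open>d\<close>, so these terms cancel in the difference.\<close>

lemma dual_admissible_inner_eq:
  assumes "dual_admissible \<Omega> a H b" "dual_admissible \<Omega> a H c"
    and u: "H10 \<Omega> u Du" and H: "L2 \<Omega> H" and F: "L2 \<Omega> F"
  shows "(LINT x|lebesgue_on \<Omega>. (Du x + F x) \<bullet> b x) - (LINT x|lebesgue_on \<Omega>. (Du x + F x) \<bullet> c x)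
       = (LINT x|lebesgue_on \<Omega>. F x \<bullet> b x) - (LINT x|lebesgue_on \<Omega>. F x \<bullet> c x)"
proof -
  have l2: "L2 \<Omega> u" "L2 \<Omega> Du" using u by (auto simp: H10_def H1_def)
  have "(LINT x|lebesgue_on \<Omega>. (Du x + F x) \<bullet> d x)
      = (LINT x|lebesgue_on \<Omega>. F x \<bullet> d x) - (LINT x|lebesgue_on \<Omega>. H x * u x)"
    if d: "dual_admissible \<Omega> a H d" for d
  proof -
    have dL2: "L2 \<Omega> d" using d by (simp add: dual_admissible_def)
    have int: "integrable (lebesgue_on \<Omega>) (\<lambda>x. Du x \<bullet> d x)" "integrable (lebesgue_on \<Omega>) (\<lambda>x. F x \<bullet> d x)"
        "integrable (lebesgue_on \<Omega>) (\<lambda>x. H x * u x)"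
      using integrable_inner_L2[OF l2(2) dL2] integrable_inner_L2[OF F dL2]
        integrable_inner_L2[OF H l2(1)] by auto
    have "(LINT x|lebesgue_on \<Omega>. Du x \<bullet> d x + H x * u x) = 0"
      using d u by (simp add: dual_admissible_def)
    with int show ?thesis by (simp add: inner_add_left)
  qed
  from this[OF assms(1)] this[OF assms(2)] show ?thesis by simp
qed

text \<open>
  The gap \<open>p \<bullet> (a p / |p|) - p \<bullet> c\<close> controls the squared distance of \<open>c\<close> from \<open>a p / |p|\<close>, since
  \<open>|a p / |p| - c|\<^sup>2 \<le> 2 a\<^sup>2 - 2 (a p / |p|) \<bullet> c\<close>.
\<close>

lemma norm_diff_normalized_le:
  fixes p c :: "'a::real_inner"
  assumes "p \<noteq> 0" "norm c \<le> \<alpha>" "\<alpha> / norm p \<le> s"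
  shows "(norm ((\<alpha> / norm p) *\<^sub>R p - c))\<^sup>2
           \<le> 2 * s * (p \<bullet> ((\<alpha> / norm p) *\<^sub>R p) - p \<bullet> c)"
proof -
  have \<alpha>: "0 \<le> \<alpha>" using assms(2) norm_ge_zero[of c] by linarith
  have pp: "p \<bullet> ((\<alpha> / norm p) *\<^sub>R p) = \<alpha> * norm p"
    using assms(1) by (simp add: dot_square_norm power2_eq_square)
  \<comment> \<open>The gap must be nonnegative for its factor \<open>\<alpha> / norm p\<close> to
    be replaced by the upper bound \<open>s\<close> at the end.\<close>
  have "p \<bullet> c \<le> norm p * norm c" by (rule norm_cauchy_schwarz)
  also have "\<dots> \<le> \<alpha> * norm p" using assms(2) by (subst mult.commute) (rule mult_right_mono, auto)
  finally have gap: "0 \<le> \<alpha> * norm p - p \<bullet> c" by simp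
  have "(norm ((\<alpha> / norm p) *\<^sub>R p - c))\<^sup>2
      = (norm ((\<alpha> / norm p) *\<^sub>R p))\<^sup>2 - 2 * (((\<alpha> / norm p) *\<^sub>R p) \<bullet> c) + (norm c)\<^sup>2"
    by (simp only: power2_norm_eq_inner) (simp add: inner_diff inner_commute)
  also have "\<dots> = \<alpha>\<^sup>2 - 2 * (\<alpha> / norm p) * (p \<bullet> c) + (norm c)\<^sup>2"
    using assms(1) \<alpha> by simp
  also have "\<dots> \<le> 2 * \<alpha>\<^sup>2 - 2 * (\<alpha> / norm p) * (p \<bullet> c)"
    using power_mono[OF assms(2), of 2] by simp
  also have "\<dots> = 2 * (\<alpha> / norm p) * (\<alpha> * norm p - p \<bullet> c)"
    using assms(1) by (simp add: field_simps power2_eq_square)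
  also have "\<dots> \<le> 2 * s * (\<alpha> * norm p - p \<bullet> c)"
    using assms(3) gap by (intro mult_right_mono) auto
  finally show ?thesis unfolding pp .
qed

text \<open>The pointwise gap estimate is integrated, and the constraint then trades
  \<open>Du + F\<close> for \<open>F\<close>. The outcome is a quantitative uniqueness statement: an
  admissible field whose dual value is close to that of \<open>b\<close> is close to
  \<open>b\<close> in \<open>L2\<close>.\<close>

lemma dual_admissible_distance_le:
  assumes \<Omega>: "open \<Omega>" "bounded \<Omega>"
    and a: "a \<in> borel_measurable (lebesgue_on \<Omega>)"
    and bounds: "AE x in lebesgue_on \<Omega>. 0 < a x \<and> a x \<le> M"
    and H: "L2 \<Omega> H" and F: "L2 \<Omega> F"
    and min: "energy_minimizer \<Omega> a H F u Du"
    and cond: "AE x in lebesgue_on \<Omega>. conductivity a F Du x \<le> ereal s"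
    and c: "dual_admissible \<Omega> a H c"
  defines "b \<equiv> \<lambda>x. (a x / norm (Du x + F x)) *\<^sub>R (Du x + F x)"
  shows "(LINT x|lebesgue_on \<Omega>. (norm (b x - c x))\<^sup>2)
     \<le> 2 * s * ((LINT x|lebesgue_on \<Omega>. F x \<bullet> b x) - (LINT x|lebesgue_on \<Omega>. F x \<bullet> c x))"
proof -
  have u: "H10 \<Omega> u Du" using min by (simp add: energy_minimizer_def)
  then have p: "L2 \<Omega> (\<lambda>x. Du x + F x)"
    using F by (auto simp: H10_def H1_def intro: L2_add)
  have b: "dual_admissible \<Omega> a H b"
    unfolding b_def by (rule energy_minimizer_dual_admissible[OF \<Omega> a bounds H F min cond])
  have L2: "L2 \<Omega> b" "L2 \<Omega> c" using b c by (auto simp: dual_admissible_def)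
  have nc: "AE x in lebesgue_on \<Omega>. norm (c x) \<le> a x" using c by (simp add: dual_admissible_def)
  have int: "integrable (lebesgue_on \<Omega>) (\<lambda>x. (Du x + F x) \<bullet> b x)"
      "integrable (lebesgue_on \<Omega>) (\<lambda>x. (Du x + F x) \<bullet> c x)"
    using p L2 by (auto intro: integrable_inner_L2)
  have "(LINT x|lebesgue_on \<Omega>. (norm (b x - c x))\<^sup>2)
      \<le> (LINT x|lebesgue_on \<Omega>. 2 * s * ((Du x + F x) \<bullet> b x - (Du x + F x) \<bullet> c x))"
  proof (rule integral_mono_AE)
    show "integrable (lebesgue_on \<Omega>) (\<lambda>x. (norm (b x - c x))\<^sup>2)"
      using L2_diff[OF L2] by (simp add: L2_def)
    show "integrable (lebesgue_on \<Omega>) (\<lambda>x. 2 * s * ((Du x + F x) \<bullet> b x - (Du x + F x) \<bullet> c x))"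
      using int by (intro integrable_mult_right Bochner_Integration.integrable_diff)
    show "AE x in lebesgue_on \<Omega>.
        (norm (b x - c x))\<^sup>2 \<le> 2 * s * ((Du x + F x) \<bullet> b x - (Du x + F x) \<bullet> c x)"
      using bounds cond nc
    proof eventually_elim
      case (elim x)
      with conductivity_leD[of a x F Du s] show ?case
        unfolding b_def by (intro norm_diff_normalized_le) auto
    qed
  qed
  also have "\<dots> = 2 * s * ((LINT x|lebesgue_on \<Omega>. (Du x + F x) \<bullet> b x)
      - (LINT x|lebesgue_on \<Omega>. (Du x + F x) \<bullet> c x))"
    using int by simp
  finally show ?thesis
    by (simp add: dual_admissible_inner_eq[OF b c u H F])
qed

section \<open>Stability of the flux field under perturbation of \<open>F\<close>\<close>

theorem theorem3p3:
  fixes \<Omega> :: "(real^'n) set"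
    and a H u u' :: "real^'n \<Rightarrow> real"
    and F F' Du Du' J J' :: "real^'n \<Rightarrow> real^'n"
    and m M \<sigma>1 :: real
  assumes "open \<Omega>" and "bounded \<Omega>" and "connected \<Omega>" and "lipschitz_boundary \<Omega>"
    and "a \<in> borel_measurable (lebesgue_on \<Omega>)"
    and "0 < m" and "AE x in lebesgue_on \<Omega>. m \<le> a x \<and> a x \<le> M"
    and "L2 \<Omega> H" and "L2 \<Omega> F" and "L2 \<Omega> F'"
    and "energy_minimizer \<Omega> a H F u Du"
    and "energy_minimizer \<Omega> a H F' u' Du'"
    and "flux_field \<Omega> a H F J"
    and "flux_field \<Omega> a H F' J'"
    and "\<sigma>1 > 0"
    and "AE x in lebesgue_on \<Omega>. 0 \<le> conductivity a F Du x \<and> conductivity a F Du x \<le> ereal \<sigma>1"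
  shows "(LINT x|lebesgue_on \<Omega>. norm (J x - J' x))
           \<le> sqrt (4 * M * \<sigma>1 * measure lebesgue \<Omega>)
             * sqrt (LINT x|lebesgue_on \<Omega>. norm (F x - F' x))"
proof -
  note \<Omega> = \<open>open \<Omega>\<close> \<open>bounded \<Omega>\<close>
  have \<Omega>m: "\<Omega> \<in> lmeasurable" using \<Omega> by (simp add: lmeasurable_open)
  have bounds: "AE x in lebesgue_on \<Omega>. 0 < a x \<and> a x \<le> M"
    using assms(7) by eventually_elim (use \<open>0 < m\<close> in auto)
  have cond: "AE x in lebesgue_on \<Omega>. conductivity a F Du x \<le> ereal \<sigma>1"
    using assms(16) by eventually_elim simp
  note F = \<open>L2 \<Omega> F\<close> and F' = \<open>L2 \<Omega> F'\<close> and H = \<open>L2 \<Omega> H\<close>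
  have J: "dual_admissible \<Omega> a H J" and J': "dual_admissible \<Omega> a H J'"
    using assms(13,14) by (auto simp: flux_field_def)
  then have L2J: "L2 \<Omega> J" "L2 \<Omega> J'" by (auto simp: dual_admissible_def)
  have nJ: "AE x in lebesgue_on \<Omega>. norm (J x) \<le> a x" "AE x in lebesgue_on \<Omega>. norm (J' x) \<le> a x"
    using J J' by (auto simp: dual_admissible_def)
  define b where "b = (\<lambda>x. (a x / norm (Du x + F x)) *\<^sub>R (Du x + F x))"
  have b: "dual_admissible \<Omega> a H b"
    unfolding b_def
    by (rule energy_minimizer_dual_admissible[OF \<Omega> assms(5) bounds H F assms(11) cond])
  then have L2b: "L2 \<Omega> b" by (simp add: dual_admissible_def)
  have dist: "(LINT x|lebesgue_on \<Omega>. (norm (b x - c x))\<^sup>2)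
      \<le> 2 * \<sigma>1 * ((LINT x|lebesgue_on \<Omega>. F x \<bullet> b x) - (LINT x|lebesgue_on \<Omega>. F x \<bullet> c x))"
    if "dual_admissible \<Omega> a H c" for c
    unfolding b_def
    by (rule dual_admissible_distance_le[OF \<Omega> assms(5) bounds H F assms(11) cond that])
  have bJ: "(LINT x|lebesgue_on \<Omega>. F x \<bullet> b x) \<le> (LINT x|lebesgue_on \<Omega>. F x \<bullet> J x)"
    using assms(13) b by (simp add: flux_field_def)
  \<comment> \<open>The admissible set depends on \<open>a\<close> and \<open>H\<close> but not on
    \<open>F\<close>, so \<open>J\<close> competes with \<open>J'\<close> in the problem for
    \<open>F'\<close>.\<close>
  have JJ': "(LINT x|lebesgue_on \<Omega>. F' x \<bullet> J x) \<le> (LINT x|lebesgue_on \<Omega>. F' x \<bullet> J' x)"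
    using assms(14) J by (simp add: flux_field_def)
  \<comment> \<open>Since \<open>J\<close> maximizes the dual functional, the bound in
    \<open>dist\<close> is nonpositive for \<open>c = J\<close>; hence \<open>J\<close> and
    \<open>b\<close> agree almost everywhere.\<close>
  have "(LINT x|lebesgue_on \<Omega>. (norm (b x - J x))\<^sup>2) \<le> 0"
    using dist[OF J] bJ \<open>\<sigma>1 > 0\<close>
    by (smt (verit, best) mult_nonneg_nonpos)
  then have "(LINT x|lebesgue_on \<Omega>. (norm (b x - J x))\<^sup>2) = 0"
    by (simp add: order_antisym)
  then have eq: "AE x in lebesgue_on \<Omega>. b x = J x"
    using L2_diff[OF L2b L2J(1)] by (subst (asm) integral_nonneg_eq_0_iff_AE) (auto simp: L2_def)
  have [measurable]: "b \<in> borel_measurable (lebesgue_on \<Omega>)" "J \<in> borel_measurable (lebesgue_on \<Omega>)"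
      "J' \<in> borel_measurable (lebesgue_on \<Omega>)" "F \<in> borel_measurable (lebesgue_on \<Omega>)"
    using L2b L2J F by (auto simp: L2_def)
  have FbJ: "(LINT x|lebesgue_on \<Omega>. F x \<bullet> b x) = (LINT x|lebesgue_on \<Omega>. F x \<bullet> J x)"
    by (rule integral_cong_AE) (use eq in \<open>auto elim: eventually_mono\<close>)
  have int: "integrable (lebesgue_on \<Omega>) (\<lambda>x. F x \<bullet> J x)" "integrable (lebesgue_on \<Omega>) (\<lambda>x. F x \<bullet> J' x)"
      "integrable (lebesgue_on \<Omega>) (\<lambda>x. F' x \<bullet> J x)" "integrable (lebesgue_on \<Omega>) (\<lambda>x. F' x \<bullet> J' x)"
    using F F' L2J by (auto intro: integrable_inner_L2)
  define D where "D = (LINT x|lebesgue_on \<Omega>. norm (F x - F' x))"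
  have intD: "integrable (lebesgue_on \<Omega>) (\<lambda>x. norm (F x - F' x))"
    using integrable_norm_mult_L2[OF L2_diff[OF F F'] L2_bounded[OF \<Omega>m, of "\<lambda>x. 1::real" 1]] by simp
  have "(LINT x|lebesgue_on \<Omega>. (norm (J x - J' x))\<^sup>2) = (LINT x|lebesgue_on \<Omega>. (norm (b x - J' x))\<^sup>2)"
    by (rule integral_cong_AE) (use eq in \<open>auto elim: eventually_mono\<close>)
  also have "\<dots> \<le> 2 * \<sigma>1 * ((LINT x|lebesgue_on \<Omega>. F x \<bullet> J x) - (LINT x|lebesgue_on \<Omega>. F x \<bullet> J' x))"
    using dist[OF J'] by (simp add: FbJ)
  \<comment> \<open>By \<open>JJ'\<close> the integral of \<open>F' x \<bullet> (J x - J' x)\<close>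
    is at most 0, so subtracting it only enlarges the right-hand side.\<close>
  also have "\<dots> \<le> 2 * \<sigma>1 * (LINT x|lebesgue_on \<Omega>. (F x - F' x) \<bullet> (J x - J' x))"
    using \<open>\<sigma>1 > 0\<close> JJ' int by (simp add: inner_diff)
  also have "\<dots> \<le> 2 * \<sigma>1 * (2 * M * D)"
  proof (rule mult_left_mono)
    have "(LINT x|lebesgue_on \<Omega>. (F x - F' x) \<bullet> (J x - J' x))
        \<le> (LINT x|lebesgue_on \<Omega>. 2 * M * norm (F x - F' x))"
    proof (rule integral_mono_AE)
      show "integrable (lebesgue_on \<Omega>) (\<lambda>x. (F x - F' x) \<bullet> (J x - J' x))"
        by (rule integrable_inner_L2[OF L2_diff[OF F F'] L2_diff[OF L2J]])
      show "integrable (lebesgue_on \<Omega>) (\<lambda>x. 2 * M * norm (F x - F' x))"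
        using intD by simp
      show "AE x in lebesgue_on \<Omega>. (F x - F' x) \<bullet> (J x - J' x) \<le> 2 * M * norm (F x - F' x)"
        using bounds nJ
      proof eventually_elim
        case (elim x)
        have "(F x - F' x) \<bullet> (J x - J' x) \<le> norm (F x - F' x) * norm (J x - J' x)"
          by (rule norm_cauchy_schwarz)
        \<comment> \<open>Both fluxes are bounded in norm by \<open>a x\<close>, hence by
          \<open>M\<close>; this is one factor 2 of the constant 4, the other coming from
          \<open>dist\<close>.\<close>
        also have "\<dots> \<le> norm (F x - F' x) * (2 * M)"
          using elim norm_triangle_ineq4[of "J x" "J' x"] by (intro mult_left_mono) auto
        finally show ?case by (simp add: mult.commute)
      qed
    qed
    then show "(LINT x|lebesgue_on \<Omega>. (F x - F' x) \<bullet> (J x - J' x)) \<le> 2 * M * D"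
      by (simp add: D_def)
  qed (use \<open>\<sigma>1 > 0\<close> in simp)
  finally have S: "(LINT x|lebesgue_on \<Omega>. (norm (J x - J' x))\<^sup>2) \<le> 4 * M * \<sigma>1 * D"
    by (simp add: algebra_simps)
  have "(LINT x|lebesgue_on \<Omega>. norm (J x - J' x))\<^sup>2
      \<le> measure lebesgue \<Omega> * (LINT x|lebesgue_on \<Omega>. (norm (J x - J' x))\<^sup>2)"
    by (rule L2_norm_integral_power2_le[OF \<Omega>m L2_diff[OF L2J]])
  also have "\<dots> \<le> measure lebesgue \<Omega> * (4 * M * \<sigma>1 * D)"
    by (rule mult_left_mono[OF S]) simp
  finally have "(LINT x|lebesgue_on \<Omega>. norm (J x - J' x))\<^sup>2 \<le> 4 * M * \<sigma>1 * measure lebesgue \<Omega> * D"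
    by (simp add: algebra_simps)
  then have "(LINT x|lebesgue_on \<Omega>. norm (J x - J' x)) \<le> sqrt (4 * M * \<sigma>1 * measure lebesgue \<Omega> * D)"
    by (rule real_le_rsqrt)
  then show ?thesis
    by (simp add: real_sqrt_mult D_def)
qed

end
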